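(* Let $C$ be an $n$-input $\mathsf{AExp}^1$ circuit of width $k$ and degree $d$ such that $C(\vec u)\ne 0$ for some $\vec u\in\mathsf{dom}_\mathbb{R}(C)$. Then for any non-empty finite set $S\subseteq\mathbb{Q}$, if $\vec x\in S^n$ is sampled uniformly at random, $\Pr[C(\vec x)\in\{0,\bot\}]\le 8dk^2/|S|$.
   Context: Exponential polynomials. An $n$-variate integer-coefficient exponential polynomial of width $k$ and degree $d$ is a formal expression $P(\vec x)=\sum_{i=1}^k f_i(\vec x)\exp\!\big(g_i(\vec x)/h_i(\vec x)\big)$ with $f_i,g_i,h_i\in\mathbb{Z}[x_1,\dots,x_n]$ of total degree at most $d$ (fractions are formal, not simplified). Real evaluation: $P(\vec u)=\sum_i f_i(\vec u)e^{g_i(\vec u)/h_i(\vec u)}$ if $h_i(\vec u)\ne0$ for all $i$, else $P(\vec u)=\bot$; $\mathsf{dom}_\mathbb{R}(P)=\{\vec u\in\mathbb{R}^n:h_i(\vec u)\ne0\ \forall i\}$. Finite-field evaluation: for primes $p,q$ with $q\mid p-1$, $G_{p,q}$ the order-$q$ subgroup of $\mathbb{F}_p^*$, $a\in G_{p,q}$, $\vec u\in\mathbb{F}_p^n,\vec v\in\mathbb{F}_q^n$: $P_a(\vec u,\vec v)=\sum_i f_i(\vec u)a^{e_i}\bmod p$ with $e_i=g_i(\vec v)h_i(\vec v)^{-1}\in\mathbb{F}_q$ viewed as an integer in $\{0,\dots,q-1\}$, and $\bot$ if some $h_i(\vec v)\equiv0\pmod q$; $\mathsf{dom}_{p,q,a}(P)$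 is where it is defined. $\mathsf{dom}_\mathbb{R}(P/P')=\{\vec u\in\mathsf{dom}_\mathbb{R}(P)\cap\mathsf{dom}_\mathbb{R}(P'):P'(\vec u)\ne0\}$, $\mathsf{dom}_{p,q,a}(P/P')=\{(\vec u,\vec v)\in\mathsf{dom}_{p,q,a}(P)\cap\mathsf{dom}_{p,q,a}(P'):P'_a(\vec u,\vec v)\ne0\}$. $\mathsf{AExp}^1$ circuits. An $n$-input $\mathsf{AExp}^1$ circuit is a directed acyclic graph with one output gate whose vertices are input variables $x_1,\dots,x_n$ or gates (fan-out 1) of types: constant $\mathsf{C}_b$ ($b\in\mathbb{Z}$), addition and multiplication (unbounded fan-in), division $\mathsf{Frac}(x,y)$ (fan-in 2), exponentiation $\mathsf{Exp}(x)$ (fan-in 1), such that every input-to-output path contains at most one exponentiation gate. Real evaluation $C(\vec u)$, $\vec u\in\mathbb{R}^n$: gate by gate with $b$, sum, product, $x/y$, $e^x$; $C(\vec u)=\bot$ if some division gate has divisor $0$; $\mathsf{dom}_\mathbb{R}(C)=\{\vec u:C(\vec u)\ne\bot\}$. Finite-field evaluation $C_a(\vec u,\vec v)$: inputs carry pairs $(u_i,v_i)\in(\mathbb{F}_p\cup\{\bot\})\times(\mathbb{F}_q\cup\{\bot\})$; $\mathsf{C}_b\mapsto(b\bmod p,b\bmod q)$; addition, multiplication, division coordinatewise mod $p$ / mod $q$, a coordinate becoming $\bot$ when its divisor is $0$; $\mathsf{Exp}((\tau,\alpha))=(a^\alpha\bmod p,\bot)$; operations on $\bot$ give $\bot$;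 $C_a(\vec u,\vec v)$ is the first coordinate of the output; $\mathsf{dom}_{p,q,a}(C)$ is where it is not $\bot$. $C$ has width $k$ and degree $d$ if there are $n$-variate integer-coefficient exponential polynomials $P,P'$ of width $k$ and degree $d$ such that (i) $\mathsf{dom}_\mathbb{R}(C)=\mathsf{dom}_\mathbb{R}(P/P')$ and $C(\vec u)=P(\vec u)/P'(\vec u)$ there; (ii) for all primes $p,q$ with $q\mid p-1$ and $a\in G_{p,q}$, $\mathsf{dom}_{p,q,a}(C)=\mathsf{dom}_{p,q,a}(P/P')$ and $C_a(\vec u,\vec v)\equiv P_a(\vec u,\vec v)P'_a(\vec u,\vec v)^{-1}\pmod p$ there. *)

theory Defs
  imports
    "HOL-Probability.Probability"
    "HOL-Number_Theory.Number_Theory"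
    "HOL-Library.Poly_Mapping"
begin

text \<open>
  Conventions.  Indices are shifted: the variables \<open>x\<^sub>1, \<dots>, x\<^sub>n\<close> are numbered \<open>0, \<dots>, n - 1\<close>.
  A vector in \<open>A\<^sup>n\<close> is an element of \<^term>\<open>{..<n} \<rightarrow>\<^sub>E A\<close>.  The undefined value
  (bottom) is \<^term>\<open>None\<close>.  The field with \<open>p\<close> elements is represented by the residues
  \<^term>\<open>{0..<p}\<close>, as in \<^term>\<open>residue_ring p\<close>.
\<close>

section \<open>Integer polynomials in several variables\<close>

text \<open>A polynomial maps exponent vectors to coefficients.\<close>

type_synonym ipoly = "(nat \<Rightarrow>\<^sub>0 nat) \<Rightarrow>\<^sub>0 int"

definition nvariate :: "nat \<Rightarrow> ipoly \<Rightarrow> bool" where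
  "nvariate n f \<longleftrightarrow> (\<forall>m\<in>Poly_Mapping.keys f. Poly_Mapping.keys m \<subseteq> {..<n})"

definition total_degree_le :: "nat \<Rightarrow> ipoly \<Rightarrow> bool" where
  "total_degree_le d f \<longleftrightarrow>
     (\<forall>m\<in>Poly_Mapping.keys f. (\<Sum>i\<in>Poly_Mapping.keys m. Poly_Mapping.lookup m i) \<le> d)"

definition peval :: "ipoly \<Rightarrow> (nat \<Rightarrow> 'a::comm_ring_1) \<Rightarrow> 'a" where
  "peval f u =
     (\<Sum>m\<in>Poly_Mapping.keys f. of_int (Poly_Mapping.lookup f m) *
        (\<Prod>i\<in>Poly_Mapping.keys m. u i ^ Poly_Mapping.lookup m i))"

section \<open>Exponential polynomials\<close>

text \<open>The list of the triples \<open>(f\<^sub>i, g\<^sub>i, h\<^sub>i)\<close> stands for the formal sum of the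
  \<open>f\<^sub>i exp (g\<^sub>i / h\<^sub>i)\<close>.\<close>

type_synonym expoly = "(ipoly \<times> ipoly \<times> ipoly) list"

definition expoly_of :: "nat \<Rightarrow> nat \<Rightarrow> nat \<Rightarrow> expoly \<Rightarrow> bool" where
  "expoly_of n k d P \<longleftrightarrow> length P = k \<and>
     (\<forall>(f, g, h)\<in>set P. \<forall>r\<in>{f, g, h}. nvariate n r \<and> total_degree_le d r)"

definition expoly_real :: "expoly \<Rightarrow> (nat \<Rightarrow> real) \<Rightarrow> real option" where
  "expoly_real P u =
     (if \<forall>(f, g, h)\<in>set P. peval h u \<noteq> 0
      then Some (\<Sum>(f, g, h)\<leftarrow>P. peval f u * exp (peval g u / peval h u))
      else None)"

text \<open>The order-\<open>q\<close> subgroup of the multiplicative group of the field with \<open>p\<close> elements;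
  for primes \<open>p\<close>, \<open>q\<close> with \<open>q dvd p - 1\<close> it exists and is unique, as that group is cyclic
  of order \<open>p - 1\<close>.\<close>

definition Gpq :: "int \<Rightarrow> int \<Rightarrow> int set" where
  "Gpq p q = (THE H. subgroup H (units_of (residue_ring p)) \<and> card H = nat q)"

definition mod_divide :: "int \<Rightarrow> int \<Rightarrow> int \<Rightarrow> int" where
  "mod_divide p x y = (x * modular_inverse p y) mod p"

definition expoly_ff ::
    "int \<Rightarrow> int \<Rightarrow> int \<Rightarrow> expoly \<Rightarrow> (nat \<Rightarrow> int) \<Rightarrow> (nat \<Rightarrow> int) \<Rightarrow> int option" where
  "expoly_ff p q a P u v =
     (if \<forall>(f, g, h)\<in>set P. peval h v mod q \<noteq> 0
      then Some ((\<Sum>(f, g, h)\<leftarrow>P. peval f u * a ^ nat (mod_divide q (peval g v) (peval h v))) mod p)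
      else None)"

definition expoly_dom_real :: "nat \<Rightarrow> expoly \<Rightarrow> (nat \<Rightarrow> real) set" where
  "expoly_dom_real n P = {u \<in> {..<n} \<rightarrow>\<^sub>E UNIV. expoly_real P u \<noteq> None}"

definition expoly_dom_ff ::
    "nat \<Rightarrow> int \<Rightarrow> int \<Rightarrow> int \<Rightarrow> expoly \<Rightarrow> ((nat \<Rightarrow> int) \<times> (nat \<Rightarrow> int)) set" where
  "expoly_dom_ff n p q a P =
     {(u, v) \<in> ({..<n} \<rightarrow>\<^sub>E {0..<p}) \<times> ({..<n} \<rightarrow>\<^sub>E {0..<q}). expoly_ff p q a P u v \<noteq> None}"

definition quotient_dom_real :: "nat \<Rightarrow> expoly \<Rightarrow> expoly \<Rightarrow> (nat \<Rightarrow> real) set" where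
  "quotient_dom_real n P P' =
     {u \<in> expoly_dom_real n P \<inter> expoly_dom_real n P'. expoly_real P' u \<noteq> Some 0}"

definition quotient_dom_ff ::
    "nat \<Rightarrow> int \<Rightarrow> int \<Rightarrow> int \<Rightarrow> expoly \<Rightarrow> expoly \<Rightarrow> ((nat \<Rightarrow> int) \<times> (nat \<Rightarrow> int)) set" where
  "quotient_dom_ff n p q a P P' =
     {(u, v) \<in> expoly_dom_ff n p q a P \<inter> expoly_dom_ff n p q a P'. expoly_ff p q a P' u v \<noteq> Some 0}"

section \<open>Circuits with exponentiation gates\<close>

text \<open>
  A circuit is the list of its gates in a topological order, the output gate being last; a gate
  carries the references to its operands, each of which is an input variable or an earlier gate.
  Every finite directed acyclic graph admits such an order.
\<close>

datatype 'w gate =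
    Const int
  | Add "'w list"
  | Mult "'w list"
  | Frac 'w 'w
  | Exp 'w

fun operands :: "'w gate \<Rightarrow> 'w list" where
  "operands (Const b) = []"
| "operands (Add ws) = ws"
| "operands (Mult ws) = ws"
| "operands (Frac w w') = [w, w']"
| "operands (Exp w) = [w]"

datatype vertex = Input nat | Gate nat

type_synonym circuit = "vertex gate list"

definition output_gate :: "circuit \<Rightarrow> vertex" where
  "output_gate C = Gate (length C - 1)"

definition circuit_edge :: "circuit \<Rightarrow> vertex \<Rightarrow> vertex \<Rightarrow> bool" where
  "circuit_edge C w w' \<longleftrightarrow> (\<exists>j<length C. w' = Gate j \<and> w \<in> set (operands (C ! j)))"

definition is_exp_vertex :: "circuit \<Rightarrow> vertex \<Rightarrow> bool" where
  "is_exp_vertex C w \<longleftrightarrow> (\<exists>j<length C. w = Gate j \<and> (\<exists>w'. C ! j = Exp w'))"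

definition input_output_path :: "circuit \<Rightarrow> vertex list \<Rightarrow> bool" where
  "input_output_path C ws \<longleftrightarrow> ws \<noteq> [] \<and> (\<exists>i. hd ws = Input i) \<and> last ws = output_gate C \<and>
     successively (circuit_edge C) ws"

text \<open>
  The third conjunct is the fan-out condition: the wire leaving a gate is used exactly once
  (counted with multiplicity), except that the wire leaving the output gate is the circuit's
  output.  In particular, the last gate is the only sink among the gates.
\<close>

definition AExp1_circuit :: "nat \<Rightarrow> circuit \<Rightarrow> bool" where
  "AExp1_circuit n C \<longleftrightarrow>
     C \<noteq> [] \<and>
     (\<forall>j<length C. set (operands (C ! j)) \<subseteq> Input ` {..<n} \<union> Gate ` {..<j}) \<and>
     (\<forall>j<length C - 1. count_list (concat (map operands C)) (Gate j) = 1) \<and>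
     (\<forall>ws. input_output_path C ws \<longrightarrow> length (filter (is_exp_vertex C) ws) \<le> 1)"

subsection \<open>Evaluation\<close>

fun vertex_value :: "(nat \<Rightarrow> 'v) \<Rightarrow> 'v list \<Rightarrow> vertex \<Rightarrow> 'v" where
  "vertex_value u vs (Input i) = u i"
| "vertex_value u vs (Gate j) = vs ! j"

text \<open>The list of the values of all gates, where \<open>sem\<close> interprets a gate applied to the values
  of its operands.\<close>

definition gate_values :: "('v gate \<Rightarrow> 'v) \<Rightarrow> (nat \<Rightarrow> 'v) \<Rightarrow> circuit \<Rightarrow> 'v list" where
  "gate_values sem u C =
     foldl (\<lambda>vs g. vs @ [sem (map_gate (vertex_value u vs) g)]) [] C"

definition strict :: "('a list \<Rightarrow> 'b) \<Rightarrow> 'a option list \<Rightarrow> 'b option" where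
  "strict f xs = (if None \<in> set xs then None else Some (f (map the xs)))"

fun option_divide :: "('a::zero \<Rightarrow> 'a \<Rightarrow> 'a) \<Rightarrow> 'a option \<Rightarrow> 'a option \<Rightarrow> 'a option" where
  "option_divide dv (Some x) (Some y) = (if y = 0 then None else Some (dv x y))"
| "option_divide dv _ _ = None"

fun real_gate :: "real option gate \<Rightarrow> real option" where
  "real_gate (Const b) = Some (of_int b)"
| "real_gate (Add xs) = strict sum_list xs"
| "real_gate (Mult xs) = strict prod_list xs"
| "real_gate (Frac x y) = option_divide (/) x y"
| "real_gate (Exp x) = map_option exp x"

text \<open>The value \<^term>\<open>None\<close> first arises at a division gate with divisor \<open>0\<close>.\<close>

definition circuit_real :: "circuit \<Rightarrow> (nat \<Rightarrow> real) \<Rightarrow> real option" where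
  "circuit_real C u =
     (let vs = gate_values real_gate (\<lambda>i. Some (u i)) C
      in if None \<in> set vs then None else last vs)"

definition circuit_dom_real :: "nat \<Rightarrow> circuit \<Rightarrow> (nat \<Rightarrow> real) set" where
  "circuit_dom_real n C = {u \<in> {..<n} \<rightarrow>\<^sub>E UNIV. circuit_real C u \<noteq> None}"

text \<open>The exponentiation gate reads only the second coordinate of its operand.\<close>

fun ff_gate :: "int \<Rightarrow> int \<Rightarrow> int \<Rightarrow> (int option \<times> int option) gate \<Rightarrow> int option \<times> int option" where
  "ff_gate p q a (Const b) = (Some (b mod p), Some (b mod q))"
| "ff_gate p q a (Add xs) =
     (strict (\<lambda>ys. sum_list ys mod p) (map fst xs), strict (\<lambda>ys. sum_list ys mod q) (map snd xs))"
| "ff_gate p q a (Mult xs) =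
     (strict (\<lambda>ys. prod_list ys mod p) (map fst xs), strict (\<lambda>ys. prod_list ys mod q) (map snd xs))"
| "ff_gate p q a (Frac x y) =
     (option_divide (mod_divide p) (fst x) (fst y), option_divide (mod_divide q) (snd x) (snd y))"
| "ff_gate p q a (Exp x) = (map_option (\<lambda>\<alpha>. a ^ nat \<alpha> mod p) (snd x), None)"

text \<open>Here \<^term>\<open>None\<close> may occur at a gate without affecting the result, so only the first
  coordinate of the output gate matters.\<close>

definition circuit_ff ::
    "int \<Rightarrow> int \<Rightarrow> int \<Rightarrow> circuit \<Rightarrow> (nat \<Rightarrow> int option) \<Rightarrow> (nat \<Rightarrow> int option) \<Rightarrow> int option" where
  "circuit_ff p q a C u v = fst (last (gate_values (ff_gate p q a) (\<lambda>i. (u i, v i)) C))"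

definition circuit_dom_ff ::
    "nat \<Rightarrow> int \<Rightarrow> int \<Rightarrow> int \<Rightarrow> circuit \<Rightarrow> ((nat \<Rightarrow> int) \<times> (nat \<Rightarrow> int)) set" where
  "circuit_dom_ff n p q a C =
     {(u, v) \<in> ({..<n} \<rightarrow>\<^sub>E {0..<p}) \<times> ({..<n} \<rightarrow>\<^sub>E {0..<q}).
        circuit_ff p q a C (Some \<circ> u) (Some \<circ> v) \<noteq> None}"

subsection \<open>Width and degree\<close>

definition has_width_degree :: "nat \<Rightarrow> nat \<Rightarrow> nat \<Rightarrow> circuit \<Rightarrow> bool" where
  "has_width_degree n k d C \<longleftrightarrow>
     (\<exists>P P'. expoly_of n k d P \<and> expoly_of n k d P' \<and>
        circuit_dom_real n C = quotient_dom_real n P P' \<and>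
        (\<forall>u\<in>circuit_dom_real n C.
           the (circuit_real C u) = the (expoly_real P u) / the (expoly_real P' u)) \<and>
        (\<forall>p q a. prime p \<and> prime q \<and> q dvd p - 1 \<and> a \<in> Gpq p q \<longrightarrow>
           circuit_dom_ff n p q a C = quotient_dom_ff n p q a P P' \<and>
           (\<forall>(u, v)\<in>circuit_dom_ff n p q a C.
              [the (circuit_ff p q a C (Some \<circ> u) (Some \<circ> v)) =
                 the (expoly_ff p q a P u v) * modular_inverse p (the (expoly_ff p q a P' u v))]
              (mod p))))"

end

theory Submission
  imports Defs
begin

text \<open>
  The real numbers \<open>exp r\<close>, for distinct rational \<open>r\<close>, are linearly independent over the rationals;
  since the exponents have a common denominator, this is Hermite's argument for the transcendence of
  \<open>e\<close> and needs no Lindemann--Weierstrass theorem.  Collect the terms \<open>f\<^sub>i exp (g\<^sub>i / h\<^sub>i)\<close> of a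
  nonzero exponential polynomial by their exponents.  For some class \<open>I\<close> of equal exponents,
  \<open>\<Sum>i\<in>I. f\<^sub>i\<close> is a nonzero polynomial.  A rational point can be bad only if it is a zero of an \<open>h\<^sub>i\<close>,
  of this sum, or of a difference \<open>g\<^sub>j h\<^sub>i - g\<^sub>i h\<^sub>j\<close> for a fixed \<open>i\<close> in \<open>I\<close> and some \<open>j\<close> outside \<open>I\<close>:
  otherwise the coefficient of one exponential does not vanish.  By Schwartz--Zippel these zeros
  have density at most \<open>(k d + d + 2 k d) / card S \<le> 4 d k\<^sup>2 / card S\<close>, and numerator and denominator
  of the circuit contribute one such term each.
\<close>

section \<open>Linear independence of exponentials of rationals\<close>

text \<open>Hermite's sum f + f' + f'' + ...: multiplied by -exp(-t) it is an antiderivative of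
  exp(-t) f(t). Derivatives beyond the degree vanish, so the finite range loses nothing.\<close>

definition deriv_sum :: "real poly \<Rightarrow> real poly" where
  "deriv_sum f = (\<Sum>j\<le>Polynomial.degree f. (pderiv ^^ j) f)"

text \<open>Differentiation shifts the sum by one place, and the term that enters at the top is
  zero.\<close>

lemma pderiv_deriv_sum: "pderiv (deriv_sum f) = deriv_sum f - f"
proof -
  have "(pderiv ^^ Suc (Polynomial.degree f)) f = 0"
    by (rule poly_eqI) (simp add: coeff_higher_pderiv coeff_eq_0 del: funpow.simps)
  then have "deriv_sum f = (\<Sum>j\<le>Suc (Polynomial.degree f). (pderiv ^^ j) f)"
    by (simp add: deriv_sum_def)
  also have "\<dots> = f + (\<Sum>j\<le>Polynomial.degree f. (pderiv ^^ Suc j) f)"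
    by (subst sum.atMost_Suc_shift) simp
  also have "(\<Sum>j\<le>Polynomial.degree f. (pderiv ^^ Suc j) f) = pderiv (deriv_sum f)"
    using higher_pderiv_sum[of 1 "\<lambda>j. (pderiv ^^ j) f"] by (simp add: deriv_sum_def)
  finally show ?thesis by simp
qed

lemma higher_pderiv_pcompose_shift:
  "(pderiv ^^ j) (pcompose f [:x, 1:]) = pcompose ((pderiv ^^ j) f) [:x, 1:]"
  by (induction j) (simp_all add: pderiv_pcompose pderiv_pCons)

text \<open>The coefficients of the shifted polynomial are the Taylor coefficients at
  \<open>x\<close>; this form exhibits the factorials needed for divisibility.\<close>

lemma poly_deriv_sum:
  "poly (deriv_sum f) x = (\<Sum>j\<le>Polynomial.degree f. fact j * Polynomial.coeff (pcompose f [:x, 1:]) j)"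
proof -
  have "poly ((pderiv ^^ j) f) x = fact j * Polynomial.coeff (pcompose f [:x, 1:]) j" for j
  proof -
    have "poly ((pderiv ^^ j) f) x = Polynomial.coeff ((pderiv ^^ j) (pcompose f [:x, 1:])) 0"
      by (simp add: higher_pderiv_pcompose_shift)
    then show ?thesis
      by (simp add: coeff_higher_pderiv pochhammer_fact)
  qed
  then show ?thesis
    by (simp add: deriv_sum_def poly_sum)
qed

text \<open>The mean value inequality for \<open>\<phi>\<close>, whose derivative is -exp(-t) f(t),
  takes the place of Hermite's integral. One factor exp M bounds that derivative, the other comes
  from multiplying back by exp x.\<close>

lemma deriv_sum_exp_bound:
  assumes "\<bar>x\<bar> \<le> M" and W: "\<And>t. \<bar>t\<bar> \<le> M \<Longrightarrow> \<bar>poly f t\<bar> \<le> W"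
  shows "\<bar>poly (deriv_sum f) x - exp x * poly (deriv_sum f) 0\<bar> \<le> exp (2 * M) * M * W"
proof -
  define \<phi> where "\<phi> t = exp (- t) * poly (deriv_sum f) t" for t
  have "M \<ge> 0" using assms(1) by linarith
  then have "W \<ge> 0" using W[of 0] by simp
  have "norm (\<phi> x - \<phi> 0) \<le> (exp M * W) * norm (x - 0)"
  proof (rule field_differentiable_bound)
    show "convex (cball 0 M :: real set)" by simp
    show "(\<phi> has_field_derivative - exp (- t) * poly f t) (at t within cball 0 M)" for t
      unfolding \<phi>_def
      by (auto intro!: derivative_eq_intros simp: pderiv_deriv_sum algebra_simps)
    fix t :: real assume "t \<in> cball 0 M"
    then show "norm (- exp (- t) * poly f t) \<le> exp M * W"
      using W[of t] by (auto simp: abs_mult intro!: mult_mono)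
  qed (use assms \<open>M \<ge> 0\<close> in auto)
  also have "\<dots> \<le> (exp M * W) * M"
    using assms(1) \<open>W \<ge> 0\<close> by (intro mult_left_mono) auto
  finally have *: "\<bar>\<phi> x - \<phi> 0\<bar> \<le> exp M * W * M" by simp
  have "poly (deriv_sum f) x - exp x * poly (deriv_sum f) 0 = exp x * (\<phi> x - \<phi> 0)"
    by (simp add: \<phi>_def algebra_simps flip: exp_add)
  then have "\<bar>poly (deriv_sum f) x - exp x * poly (deriv_sum f) 0\<bar> = exp x * \<bar>\<phi> x - \<phi> 0\<bar>"
    by (simp add: abs_mult)
  also have "\<dots> \<le> exp M * (exp M * W * M)"
    using * assms(1) by (intro mult_mono) auto
  also have "\<dots> = exp (2 * M) * M * W"
    using exp_add[of M M] by simp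
  finally show ?thesis .
qed

section \<open>Integer coefficients and divisibility by factorials\<close>

definition integral_poly :: "'a::ring_1 poly \<Rightarrow> bool" where
  "integral_poly f \<longleftrightarrow> (\<forall>i. Polynomial.coeff f i \<in> \<int>)"

lemma integral_poly_linear: "a \<in> \<int> \<Longrightarrow> b \<in> \<int> \<Longrightarrow> integral_poly [:a, b:]"
  by (auto simp: integral_poly_def coeff_pCons split: nat.splits)

lemma integral_poly_mult:
  fixes f g :: "'a::comm_ring_1 poly"
  shows "integral_poly f \<Longrightarrow> integral_poly g \<Longrightarrow> integral_poly (f * g)"
  by (auto simp: integral_poly_def coeff_mult intro!: Ints_sum Ints_mult)

lemma integral_poly_power:
  fixes f :: "'a::comm_ring_1 poly"
  shows "integral_poly f \<Longrightarrow> integral_poly (f ^ m)"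
  by (induction m) (auto intro!: integral_poly_mult, auto simp: integral_poly_def)

lemma integral_poly_prod:
  fixes f :: "'b \<Rightarrow> 'a::comm_ring_1 poly"
  shows "(\<And>i. i \<in> I \<Longrightarrow> integral_poly (f i)) \<Longrightarrow> integral_poly (prod f I)"
  by (induction I rule: infinite_finite_induct)
     (auto intro!: integral_poly_mult, auto simp: integral_poly_def)

lemma pcompose_power:
  fixes f :: "'a::comm_semiring_1 poly"
  shows "pcompose (f ^ m) g = pcompose f g ^ m"
  by (induction m) (simp_all add: pcompose_1 pcompose_mult)

text \<open>A zero of order at least \<open>m\<close> kills the Taylor coefficients below
  \<open>m\<close>; those above \<open>m\<close> are integers whose factorials are divisible by (m +
  1)!. The term at \<open>m\<close> is kept apart, since for \<open>m = p - 1\<close> it decides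
  divisibility by p!.\<close>

lemma deriv_sum_shifted_multiple:
  assumes "pcompose f [:x, 1:] = [:0, 1:] ^ m * R" and "integral_poly R"
  shows "\<exists>z. poly (deriv_sum f) x = fact m * Polynomial.coeff R 0 + fact (Suc m) * of_int z"
proof -
  have c: "Polynomial.coeff (pcompose f [:x, 1:]) j = (if j < m then 0 else Polynomial.coeff R (j - m))" for j
    using coeff_monom_mult[of 1 m R j] by (simp add: assms(1) monom_altdef)
  have deg: "Polynomial.degree (pcompose f [:x, 1:]) = Polynomial.degree f"
    by (simp add: degree_pcompose)
  have "\<exists>z. fact j * Polynomial.coeff (pcompose f [:x, 1:]) j
      = (if j = m then fact m * Polynomial.coeff R 0 else 0) + fact (Suc m) * of_int z" for j
  proof -
    consider "j < m" | "j = m" | "j \<ge> Suc m" by linarith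
    then show ?thesis
    proof cases
      case 3
      obtain z1 where z1: "Polynomial.coeff R (j - m) = of_int z1"
        using assms(2) by (auto simp: integral_poly_def elim: Ints_cases)
      have "(fact (Suc m) :: int) dvd fact j" using 3 by (rule fact_dvd)
      then obtain z2 where "fact j = fact (Suc m) * (z2 :: int)" by (elim dvdE)
      then have "real_of_int (fact j) = of_int (fact (Suc m) * z2)" by (simp only:)
      then have "(fact j :: real) = fact (Suc m) * of_int z2" by (simp only: of_int_fact of_int_mult)
      then show ?thesis using 3 z1 c[of j] by (intro exI[of _ "z2 * z1"]) (simp add: mult_ac)
    qed (auto simp: c intro: exI[of _ 0])
  qed
  then obtain z where z: "\<And>j. fact j * Polynomial.coeff (pcompose f [:x, 1:]) j
      = (if j = m then fact m * Polynomial.coeff R 0 else 0) + fact (Suc m) * of_int (z j)"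
    by metis
  \<comment> \<open>If \<open>m\<close> exceeds the degree, the sum has no term with index
    \<open>m\<close>, so the isolated term must be zero.\<close>
  have "Polynomial.coeff R 0 = 0" if "\<not> m \<le> Polynomial.degree f"
    using c[of m] that deg by (simp add: coeff_eq_0)
  then have "poly (deriv_sum f) x
      = fact m * Polynomial.coeff R 0 + fact (Suc m) * of_int (\<Sum>j\<le>Polynomial.degree f. z j)"
    unfolding poly_deriv_sum z by (auto simp: sum.distrib sum_distrib_left)
  then show ?thesis by blast
qed

section \<open>Nonvanishing of integer combinations of exponentials\<close>

lemma eventually_power_less_fact:
  fixes A B :: real
  shows "eventually (\<lambda>n. A * B ^ n < fact n) sequentially"
proof -
  have "(\<lambda>n. B ^ n /\<^sub>R fact n) \<longlonglongrightarrow> 0"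
    by (intro summable_LIMSEQ_zero summable_exp_generic)
  then have "(\<lambda>n. A * (B ^ n /\<^sub>R fact n)) \<longlonglongrightarrow> 0"
    by (rule tendsto_mult_right_zero)
  then have "eventually (\<lambda>n. A * (B ^ n /\<^sub>R fact n) < 1) sequentially"
    by (rule order_tendstoD) simp
  then show ?thesis
    by eventually_elim (simp add: field_simps)
qed

text \<open>With \<open>p\<close> a large prime, \<^term>\<open>deriv_sum f\<close> takes values at the nodes \<open>k / N\<close> that are
  multiples of \<open>(p - 1)!\<close>; only the one at \<open>0\<close> is not a multiple of \<open>p!\<close>.\<close>

lemma exp_sum_nonzero_int:
  fixes K :: "int set" and c :: "int \<Rightarrow> int" and N :: int
  assumes K: "finite K" "0 \<in> K" and c0: "c 0 \<noteq> 0" and N: "N > 0"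
  shows "(\<Sum>k\<in>K. of_int (c k) * exp (of_int k / of_int N :: real)) \<noteq> 0"
proof
  assume zero: "(\<Sum>k\<in>K. of_int (c k) * exp (of_int k / of_int N :: real)) = 0"
  \<comment> \<open>\<open>M\<close> bounds the nodes; on [-M, M], \<open>L\<close> bounds every
    linear factor of the auxiliary polynomial \<open>f\<close>. \<open>A\<close> is what the prime
    must not divide, \<open>c1\<close> the constant of the error term, and \<open>m\<close> the
    number of linear factors, the one for 0 included.\<close>
  define M :: real where "M = (\<Sum>k\<in>K. \<bar>of_int k\<bar>)"
  define L :: real where "L = 1 + of_int N * M + M"
  define A where "A = c 0 * N * (\<Prod>k\<in>K - {0}. k)"
  define c1 where "c1 = (\<Sum>k\<in>K. \<bar>of_int (c k)\<bar>) * exp (2 * M) * M"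
  define m where "m = Suc (card (K - {0}))"
  have M0: "M \<ge> 0" by (simp add: M_def sum_nonneg)
  have kM: "\<bar>of_int k\<bar> \<le> M" if "k \<in> K" for k
    unfolding M_def using that K by (intro member_le_sum) auto
  have kNM: "\<bar>of_int k / of_int N\<bar> \<le> M" if "k \<in> K" for k
  proof -
    have "\<bar>of_int k / of_int N\<bar> \<le> \<bar>of_int k :: real\<bar>"
      using N by (simp add: divide_le_eq mult_le_cancel_left1)
    then show ?thesis using kM[OF that] by linarith
  qed
  have L1: "L \<ge> 1" unfolding L_def using M0 N by simp
  have A0: "A \<noteq> 0" unfolding A_def using c0 N K by (auto simp: prod_zero_iff)
  \<comment> \<open>The extra 2 will absorb the factor p between (p - 1)! and p!, because p is at
    most \<open>2 ^ p\<close>.\<close>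
  have "eventually (\<lambda>n. c1 * (2 * L ^ m) ^ n < fact n) sequentially"
    by (rule eventually_power_less_fact)
  then obtain n0 where n0: "\<And>n. n \<ge> n0 \<Longrightarrow> c1 * (2 * L ^ m) ^ n < fact n"
    by (auto simp: eventually_sequentially)
  \<comment> \<open>Exceeding \<open>n0\<close> lets the factorial win; exceeding the absolute value
    of \<open>A\<close> keeps \<open>p\<close> from dividing the nonzero \<open>A\<close>.\<close>
  obtain p :: nat where p: "prime p" "p > max n0 (nat \<bar>A\<bar>)" using bigger_prime by blast
  \<comment> \<open>The zero at k / N has order p, except that the one at 0 has order p - 1. Scaling
    the factors by \<open>N\<close> gives every shift of \<open>f\<close> to a node integer
    coefficients.\<close>
  define f :: "real poly" where
    "f = [:0, of_int N:] ^ (p - 1) * (\<Prod>k\<in>K - {0}. [:- of_int k, of_int N:]) ^ p"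
  have p1: "Suc (p - 1) = p" using p(1) prime_gt_0_nat by simp
  have f_le: "\<bar>poly f t\<bar> \<le> (L ^ m) ^ p" if t: "\<bar>t\<bar> \<le> M" for t
  proof -
    have Nt: "\<bar>of_int N * t\<bar> \<le> of_int N * M"
      using t N by (simp add: abs_mult)
    then have "\<bar>of_int N * t\<bar> \<le> L" unfolding L_def using M0 by linarith
    then have 1: "\<bar>of_int N * t\<bar> ^ (p - 1) \<le> L ^ p"
      using L1 by (meson abs_ge_zero diff_le_self order_trans power_increasing power_mono)
    have "(\<Prod>k\<in>K - {0}. \<bar>of_int N * t - of_int k\<bar>) \<le> (\<Prod>k\<in>K - {0}. L)"
    proof (rule prod_mono, safe)
      fix k assume "k \<in> K"
      then show "\<bar>of_int N * t - of_int k\<bar> \<le> L"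
        using Nt kM[of k] unfolding L_def by linarith
    qed auto
    then have "(\<Prod>k\<in>K - {0}. \<bar>of_int N * t - of_int k\<bar>) ^ p \<le> (L ^ card (K - {0})) ^ p"
      by (intro power_mono) (auto intro: prod_nonneg)
    with 1 have "\<bar>of_int N * t\<bar> ^ (p - 1) * (\<Prod>k\<in>K - {0}. \<bar>of_int N * t - of_int k\<bar>) ^ p
        \<le> L ^ p * (L ^ card (K - {0})) ^ p"
      using L1 by (intro mult_mono zero_le_power prod_nonneg) auto
    also have "\<dots> = (L ^ m) ^ p" by (simp add: m_def power_mult_distrib)
    finally show ?thesis
      by (simp add: f_def poly_prod abs_mult power_abs abs_prod mult.commute)
  qed
  define D where "D k = poly (deriv_sum f) (of_int k / of_int N)" for k :: int
  have lin: "pcompose [:- of_int j, of_int N:] [:of_int k / of_int N, 1:]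
      = [:of_int (k - j), of_int N :: real:]" for j k :: int
    using N by (simp add: pcompose_pCons)
  have lin0: "pcompose [:0, of_int N:] [:of_int k / of_int N, 1:]
      = [:of_int k, of_int N :: real:]" for k :: int
    using N by (simp add: pcompose_pCons)
  have comp: "pcompose f [:of_int k / of_int N, 1:]
      = [:of_int k, of_int N:] ^ (p - 1) * (\<Prod>j\<in>K - {0}. [:of_int (k - j), of_int N:]) ^ p" for k
    unfolding f_def pcompose_mult pcompose_power pcompose_prod lin lin0 ..
  have N_monom: "[:0, of_int N:] = [:0, 1:] * [:of_int N :: real:]" by simp
  have D_nonzero: "\<exists>z. D k = fact (p - 1) * (of_nat p * of_int z)" if k: "k \<in> K" "k \<noteq> 0" for k
  proof -
    \<comment> \<open>At the node k / N the factor for \<open>j = k\<close> becomes N X and supplies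
      the power \<open>p\<close> of X; \<open>R\<close> is the cofactor. The constant N is written
      \<open>[:of_int N, 0:]\<close> to fit \<open>integral_poly_linear\<close>.\<close>
    define R :: "real poly" where "R = [:of_int N, 0:] ^ p * [:of_int k, of_int N:] ^ (p - 1)
        * (\<Prod>j\<in>K - {0} - {k}. [:of_int (k - j), of_int N:]) ^ p"
    have "(\<Prod>j\<in>K - {0}. [:of_int (k - j), of_int N :: real:])
        = [:0, of_int N:] * (\<Prod>j\<in>K - {0} - {k}. [:of_int (k - j), of_int N:])"
      using K k by (subst prod.remove[of _ k]) auto
    then have "pcompose f [:of_int k / of_int N, 1:] = [:0, 1:] ^ p * R"
      unfolding comp R_def by (simp only: N_monom power_mult_distrib mult_ac) simp
    moreover have "integral_poly R" unfolding R_def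
      by (intro integral_poly_mult integral_poly_power integral_poly_prod integral_poly_linear) auto
    ultimately obtain z where z: "D k = fact p * Polynomial.coeff R 0 + fact (Suc p) * of_int z"
      unfolding D_def using deriv_sum_shifted_multiple by blast
    obtain r where r: "Polynomial.coeff R 0 = of_int r"
      using \<open>integral_poly R\<close> by (auto simp: integral_poly_def elim: Ints_cases)
    have "fact p = (of_nat p * fact (p - 1) :: real)"
      using fact_Suc[of "p - 1"] unfolding p1 by simp
    then have "D k = fact (p - 1) * (of_nat p * of_int (r + int (Suc p) * z))"
      unfolding z r by (simp add: algebra_simps)
    then show ?thesis by blast
  qed
  have "\<exists>z. D 0 = fact (p - 1) * (of_int (N ^ (p - 1) * (\<Prod>k\<in>K - {0}. - k) ^ p) + of_nat p * of_int z)"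
  proof -
    define R :: "real poly" where "R = [:of_int N, 0:] ^ (p - 1)
        * (\<Prod>j\<in>K - {0}. [:of_int (0 - j), of_int N:]) ^ p"
    have "pcompose f [:of_int 0 / of_int N, 1:] = [:0, 1:] ^ (p - 1) * R"
      unfolding comp R_def by (simp only: N_monom power_mult_distrib mult_ac of_int_0) simp
    moreover have "integral_poly R" unfolding R_def
      by (intro integral_poly_mult integral_poly_power integral_poly_prod integral_poly_linear) auto
    ultimately obtain z where z: "D 0 = fact (p - 1) * Polynomial.coeff R 0 + fact (Suc (p - 1)) * of_int z"
      unfolding D_def using deriv_sum_shifted_multiple by blast
    have "Polynomial.coeff R 0 = of_int (N ^ (p - 1) * (\<Prod>k\<in>K - {0}. - k) ^ p)"
      by (simp add: R_def poly_prod flip: poly_0_coeff_0)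
    moreover have "fact p = (of_nat p * fact (p - 1) :: real)"
      using fact_Suc[of "p - 1"] unfolding p1 by simp
    ultimately show ?thesis using z unfolding p1
      by (intro exI[of _ z]) (simp only: ring_distribs mult_ac)
  qed
  then obtain z0 where z0: "D 0 = fact (p - 1) *
      (of_int (N ^ (p - 1) * (\<Prod>k\<in>K - {0}. - k) ^ p) + of_nat p * of_int z0)" ..
  from D_nonzero obtain z where z: "\<And>k. k \<in> K \<Longrightarrow> k \<noteq> 0 \<Longrightarrow> D k = fact (p - 1) * (of_nat p * of_int (z k))"
    by metis
  \<comment> \<open>\<open>T\<close> is the whole sum divided by (p - 1)!. Modulo \<open>p\<close>
    only the first summand survives; it comes from the node 0.\<close>
  define T where "T = c 0 * (N ^ (p - 1) * (\<Prod>k\<in>K - {0}. - k) ^ p)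
      + int p * (c 0 * z0 + (\<Sum>k\<in>K - {0}. c k * z k))"
  have "(\<Sum>k\<in>K. of_int (c k) * D k) = of_int (c 0) * D 0 + (\<Sum>k\<in>K - {0}. of_int (c k) * D k)"
    using K by (simp add: sum.remove)
  also have "(\<Sum>k\<in>K - {0}. of_int (c k) * D k)
      = (\<Sum>k\<in>K - {0}. fact (p - 1) * (of_nat p * of_int (c k * z k)))"
    by (intro sum.cong) (auto simp: z)
  finally have sumD: "(\<Sum>k\<in>K. of_int (c k) * D k) = fact (p - 1) * of_int T"
    unfolding z0 T_def by (simp add: algebra_simps sum_distrib_left)
  have "\<not> int p dvd T"
  proof
    assume "int p dvd T"
    then have "int p dvd c 0 * (N ^ (p - 1) * (\<Prod>k\<in>K - {0}. - k) ^ p)"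
      unfolding T_def by (simp add: dvd_add_left_iff)
    moreover have pp: "prime (int p)" using p(1) by simp
    ultimately have "int p dvd c 0 \<or> int p dvd N \<or> int p dvd (\<Prod>k\<in>K - {0}. - k)"
      using prime_dvd_power[OF pp] by (auto simp: prime_dvd_mult_iff[OF pp])
    moreover have "(\<Prod>k\<in>K - {0}. - k) dvd (\<Prod>k\<in>K - {0}. k)"
      by (rule prod_dvd_prod) simp
    ultimately have "int p dvd c 0 \<or> int p dvd N \<or> int p dvd (\<Prod>k\<in>K - {0}. k)"
      by (meson dvd_trans)
    then have "int p dvd A" unfolding A_def by auto
    then have "int p \<le> \<bar>A\<bar>" using A0 dvd_imp_le_int[of A "int p"] by simp
    then show False using p(2) by linarith
  qed
  then have "T \<noteq> 0" by auto
  then have "1 \<le> \<bar>real_of_int T\<bar>" by linarith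
  then have "fact (p - 1) \<le> \<bar>\<Sum>k\<in>K. of_int (c k) * D k\<bar>"
    unfolding sumD by (simp add: abs_mult mult_le_cancel_left1)
  \<comment> \<open>Subtracting \<open>D 0\<close> times the assumed relation replaces each
    \<open>D k\<close> by an approximation error.\<close>
  also have "(\<Sum>k\<in>K. of_int (c k) * D k)
      = (\<Sum>k\<in>K. of_int (c k) * (D k - exp (of_int k / of_int N) * D 0))"
  proof -
    have "(\<Sum>k\<in>K. of_int (c k) * (D k - exp (of_int k / of_int N) * D 0))
      = (\<Sum>k\<in>K. of_int (c k) * D k) - (\<Sum>k\<in>K. of_int (c k) * exp (of_int k / of_int N)) * D 0"
      by (simp add: algebra_simps sum_subtractf sum_distrib_left)
    then show ?thesis using zero by simp
  qed
  also have "\<bar>\<dots>\<bar> \<le> (\<Sum>k\<in>K. \<bar>of_int (c k)\<bar> * (exp (2 * M) * M * (L ^ m) ^ p))"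
  proof (rule order_trans[OF sum_abs], rule sum_mono)
    fix k assume "k \<in> K"
    then have "\<bar>D k - exp (of_int k / of_int N) * D 0\<bar> \<le> exp (2 * M) * M * (L ^ m) ^ p"
      unfolding D_def using deriv_sum_exp_bound[OF kNM f_le, of k] by simp
    then show "\<bar>of_int (c k) * (D k - exp (of_int k / of_int N) * D 0)\<bar>
        \<le> \<bar>of_int (c k)\<bar> * (exp (2 * M) * M * (L ^ m) ^ p)"
      by (simp add: abs_mult mult_left_mono)
  qed
  also have "\<dots> = c1 * (L ^ m) ^ p"
    unfolding c1_def sum_distrib_right by (simp only: mult.assoc)
  \<comment> \<open>Multiplying by \<open>p\<close> turns (p - 1)! into p!, the factorial that the
    choice of \<open>p\<close> controls.\<close>
  finally have "real p * fact (p - 1) \<le> real p * (c1 * (L ^ m) ^ p)"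
    by (intro mult_left_mono) auto
  also have "\<dots> \<le> 2 ^ p * (c1 * (L ^ m) ^ p)"
  proof (rule mult_right_mono)
    show "real p \<le> 2 ^ p" using of_nat_less_two_power[of p, where 'a = real] by linarith
    show "0 \<le> c1 * (L ^ m) ^ p" unfolding c1_def using L1 M0
      by (intro mult_nonneg_nonneg sum_nonneg zero_le_power) auto
  qed
  also have "\<dots> = c1 * (2 * L ^ m) ^ p" by (simp only: power_mult_distrib mult_ac)
  also have "\<dots> < fact p" using n0[of p] p(2) by simp
  also have "fact p = (real p * fact (p - 1))" using fact_Suc[of "p - 1"] unfolding p1 by simp
  finally show False by simp
qed

section \<open>From integer data to rational exponents and coefficients\<close>

lemma Rats_finite_common_denominator:
  fixes R :: "real set"
  assumes "finite R" "R \<subseteq> \<rat>"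
  shows "\<exists>N>0. \<forall>r\<in>R. r * of_int N \<in> \<int>"
  using assms
proof (induction R rule: finite_induct)
  case (insert x R)
  then obtain N where N: "N > 0" "\<forall>r\<in>R. r * of_int N \<in> \<int>" by auto
  obtain a b where ab: "b > 0" "x = of_int a / of_int b"
    using insert.prems by (auto elim: Rats_cases')
  have "x * of_int (N * b) = of_int (a * N)" using ab by simp
  moreover have "r * of_int (N * b) \<in> \<int>" if "r \<in> R" for r
    using N that by (metis Ints_mult Ints_of_int mult.assoc of_int_mult)
  ultimately show ?case using N ab
    by (intro exI[of _ "N * b"]) (auto simp del: of_int_mult)
qed (auto intro: exI[of _ 1])

text \<open>Clear the denominators of exponents and coefficients and divide by exp s: this moves
  \<open>s\<close> to 0, where \<open>exp_sum_nonzero_int\<close> wants its nonzero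
  coefficient.\<close>

theorem exp_Rats_linear_independent:
  fixes R :: "real set" and c :: "real \<Rightarrow> real"
  assumes R: "finite R" "R \<subseteq> \<rat>" and c: "\<And>r. r \<in> R \<Longrightarrow> c r \<in> \<rat>"
    and zero: "(\<Sum>r\<in>R. c r * exp r) = 0" and s: "s \<in> R"
  shows "c s = 0"
proof (rule ccontr)
  assume cs: "c s \<noteq> 0"
  obtain N where N: "N > 0" "\<And>r. r \<in> R \<Longrightarrow> r * of_int N \<in> \<int>"
    using Rats_finite_common_denominator[OF R] by auto
  obtain N' where N': "N' > 0" "\<And>r. r \<in> R \<Longrightarrow> c r * of_int N' \<in> \<int>"
    using Rats_finite_common_denominator[of "c ` R"] R c by (auto simp: image_subset_iff)
  \<comment> \<open>The floors only convert reals known to be integral; \<open>\<rho>\<close>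
    inverts the reindexing.\<close>
  define K where "K = (\<lambda>r. \<lfloor>(r - s) * of_int N\<rfloor>) ` R"
  define \<rho> where "\<rho> k = of_int k / of_int N + s" for k :: int
  define b where "b k = \<lfloor>c (\<rho> k) * of_int N'\<rfloor>" for k
  have fl: "of_int \<lfloor>(r - s) * of_int N\<rfloor> = (r - s) * of_int N" if "r \<in> R" for r
    using N(2)[OF that] N(2)[OF s] by (simp add: algebra_simps)
  have \<rho>: "\<rho> \<lfloor>(r - s) * of_int N\<rfloor> = r" if "r \<in> R" for r
    unfolding \<rho>_def fl[OF that] using N(1) by simp
  have b: "of_int (b \<lfloor>(r - s) * of_int N\<rfloor>) = c r * of_int N'" if "r \<in> R" for r
    using N'(2)[OF that] \<rho>[OF that] by (simp add: b_def)
  have "(\<Sum>k\<in>K. of_int (b k) * exp (of_int k / of_int N :: real)) \<noteq> 0"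
  proof (rule exp_sum_nonzero_int)
    show "0 \<in> K" unfolding K_def using s by (intro image_eqI[of _ _ s]) auto
    show "b 0 \<noteq> 0" using b[OF s] cs N'(1) by auto
  qed (use R N in \<open>auto simp: K_def\<close>)
  moreover have "inj_on (\<lambda>r. \<lfloor>(r - s) * of_int N\<rfloor>) R"
    using \<rho> by (rule inj_on_inverseI)
  then have "(\<Sum>k\<in>K. of_int (b k) * exp (of_int k / of_int N :: real))
      = (\<Sum>r\<in>R. c r * of_int N' * exp (r - s))"
    unfolding K_def using N(1) by (subst sum.reindex) (auto simp: fl b intro!: sum.cong)
  moreover have "c r * of_int N' * exp (r - s) = of_int N' * exp (- s) * (c r * exp r)" for r
    by (simp add: exp_diff exp_minus divide_inverse)
  ultimately have "of_int N' * exp (- s) * (\<Sum>r\<in>R. c r * exp r) \<noteq> 0"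
    unfolding sum_distrib_left by simp
  then show False using zero by simp
qed

section \<open>Zeros of polynomial functions on a grid\<close>

inductive poly_fun :: "nat \<Rightarrow> nat \<Rightarrow> ((nat \<Rightarrow> 'a::comm_ring_1) \<Rightarrow> 'a) \<Rightarrow> bool" for n where
  const: "poly_fun n d (\<lambda>_. c)"
| add: "poly_fun n d F \<Longrightarrow> poly_fun n d G \<Longrightarrow> poly_fun n d (\<lambda>u. F u + G u)"
| mult_var: "poly_fun n d F \<Longrightarrow> i < n \<Longrightarrow> poly_fun n (Suc d) (\<lambda>u. F u * u i)"

text \<open>Scaling and relaxing the bound are joined: \<open>poly_fun_mono\<close> is the case
  \<open>c = 1\<close>, and the constant case of \<open>poly_fun_mult\<close> is an
  instance.\<close>

lemma poly_fun_scale: "poly_fun n d F \<Longrightarrow> poly_fun n (e + d) (\<lambda>u. c * F u)"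
proof (induction rule: poly_fun.induct)
  case (add d F G)
  then show ?case using poly_fun.add by (fastforce simp: distrib_left)
next
  case (mult_var d F i)
  then show ?case using poly_fun.mult_var[OF mult_var.IH] by (simp add: mult.assoc)
qed (rule poly_fun.const)

lemma poly_fun_mono: "poly_fun n d F \<Longrightarrow> d \<le> d' \<Longrightarrow> poly_fun n d' F"
  using poly_fun_scale[of n d F "d' - d" 1] by simp

lemma poly_fun_mult:
  assumes "poly_fun n d F" "poly_fun n e G"
  shows "poly_fun n (d + e) (\<lambda>u. F u * G u)"
  using assms(2)
proof (induction rule: poly_fun.induct)
  case (const e c)
  then show ?case using poly_fun_scale[OF assms(1), of e c] by (simp add: mult.commute add.commute)
next
  case (add e G H)
  then show ?case using poly_fun.add by (fastforce simp: distrib_left)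
next
  case (mult_var e G i)
  then show ?case using poly_fun.mult_var[OF mult_var.IH] by (simp add: mult.assoc)
qed

lemma poly_fun_diff:
  "poly_fun n d F \<Longrightarrow> poly_fun n d G \<Longrightarrow> poly_fun n d (\<lambda>u. F u - G u)"
  using poly_fun.add[of n d F "\<lambda>u. - 1 * G u"] poly_fun_scale[of n d G 0 "- 1"] by simp

lemma poly_fun_sum:
  "(\<And>i. i \<in> I \<Longrightarrow> poly_fun n d (F i)) \<Longrightarrow> poly_fun n d (\<lambda>u. \<Sum>i\<in>I. F i u)"
  by (induction I rule: infinite_finite_induct) (auto intro: poly_fun.const poly_fun.add)

lemma poly_fun_prod:
  "(\<And>i. i \<in> I \<Longrightarrow> poly_fun n (e i) (F i)) \<Longrightarrow> poly_fun n (sum e I) (\<lambda>u. \<Prod>i\<in>I. F i u)"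
  by (induction I rule: infinite_finite_induct) (auto intro: poly_fun.const poly_fun_mult)

lemma poly_fun_var_power: "i < n \<Longrightarrow> poly_fun n e (\<lambda>u. u i ^ e)"
proof (induction e)
  case (Suc e)
  then show ?case using poly_fun.mult_var[of n e "\<lambda>u. u i ^ e" i] by (simp add: mult.commute)
qed (simp add: poly_fun.const)

lemma poly_fun_peval:
  assumes "nvariate n f" "total_degree_le d f"
  shows "poly_fun n d (peval f)"
  unfolding peval_def
proof (rule poly_fun_sum)
  fix m assume m: "m \<in> Poly_Mapping.keys f"
  let ?c = "of_int (Poly_Mapping.lookup f m)"
  have "poly_fun n (\<Sum>i\<in>Poly_Mapping.keys m. Poly_Mapping.lookup m i)
      (\<lambda>u. \<Prod>i\<in>Poly_Mapping.keys m. u i ^ Poly_Mapping.lookup m i)"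
    using m assms(1) by (intro poly_fun_prod poly_fun_var_power) (auto simp: nvariate_def)
  then have "poly_fun n d (\<lambda>u. \<Prod>i\<in>Poly_Mapping.keys m. u i ^ Poly_Mapping.lookup m i)"
    using m assms(2) by (rule_tac poly_fun_mono) (auto simp: total_degree_le_def)
  then show "poly_fun n d (\<lambda>u. ?c * (\<Prod>i\<in>Poly_Mapping.keys m. u i ^ Poly_Mapping.lookup m i))"
    using poly_fun_scale[of n d _ 0 ?c] by simp
qed

lemma poly_fun_cong:
  "poly_fun n d F \<Longrightarrow> (\<And>i. i < n \<Longrightarrow> u i = v i) \<Longrightarrow> F u = F v"
  by (induction rule: poly_fun.induct) auto

text \<open>Expansion in powers of the last variable. Multiplying by that variable shifts the
  coefficients; multiplying by another one multiplies each coefficient and raises its bound by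
  one.\<close>

lemma poly_fun_split:
  assumes "poly_fun (Suc n) d F"
  shows "\<exists>G. (\<forall>j\<le>d. poly_fun n (d - j) (G j)) \<and> (\<forall>u. F u = (\<Sum>j\<le>d. G j u * u n ^ j))"
  using assms
proof (induction rule: poly_fun.induct)
  case (const d c)
  have "(\<Sum>j\<le>d. (if j = 0 then c else 0) * u n ^ j) = c" for u :: "nat \<Rightarrow> 'a"
    by (subst sum.remove[of _ 0]) auto
  then show ?case
    by (intro exI[of _ "\<lambda>j u. if j = 0 then c else 0"]) (auto intro: poly_fun.const)
next
  case (add d F H)
  then obtain G G' where
    "\<forall>j\<le>d. poly_fun n (d - j) (G j)" "\<forall>u. F u = (\<Sum>j\<le>d. G j u * u n ^ j)"
    "\<forall>j\<le>d. poly_fun n (d - j) (G' j)" "\<forall>u. H u = (\<Sum>j\<le>d. G' j u * u n ^ j)"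
    by blast
  then show ?case
    by (intro exI[of _ "\<lambda>j u. G j u + G' j u"])
       (auto intro: poly_fun.add simp: distrib_right sum.distrib)
next
  case (mult_var d F i)
  then obtain G where G: "\<And>j. j \<le> d \<Longrightarrow> poly_fun n (d - j) (G j)"
    "\<And>u. F u = (\<Sum>j\<le>d. G j u * u n ^ j)"
    by blast
  show ?case
  proof (cases "i = n")
    case True
    show ?thesis
    proof (intro exI conjI allI impI)
      let ?H = "\<lambda>j u. case j of 0 \<Rightarrow> 0 | Suc j \<Rightarrow> G j u"
      show "poly_fun n (Suc d - j) (?H j)" if "j \<le> Suc d" for j
        using that G(1) by (cases j) (auto intro: poly_fun.const)
      show "F u * u i = (\<Sum>j\<le>Suc d. ?H j u * u n ^ j)" for u
        by (subst sum.atMost_Suc_shift) (simp add: G(2) True sum_distrib_right sum_distrib_left mult_ac)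
    qed
  next
    case False
    show ?thesis
    proof (intro exI conjI allI impI)
      let ?H = "\<lambda>j u. (if j \<le> d then G j u * u i else 0)"
      show "poly_fun n (Suc d - j) (?H j)" if "j \<le> Suc d" for j
        using that G(1)[of j] False mult_var.hyps
        by (cases "j \<le> d") (auto intro!: poly_fun.const poly_fun.mult_var simp: Suc_diff_le)
      show "F u * u i = (\<Sum>j\<le>Suc d. ?H j u * u n ^ j)" for u
        by (simp add: G(2) sum_distrib_right sum_distrib_left mult_ac)
    qed
  qed
qed

text \<open>Let \<open>j\<close> be the largest index of a coefficient in the last variable that is
  not identically zero. Its zeros are counted by induction with bound \<open>d - j\<close>; over
  each other point the last coordinate has at most \<open>j\<close> values. The factor
  \<open>card T\<close> on the left avoids a division.\<close>

theorem Schwartz_Zippel: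
  fixes F :: "(nat \<Rightarrow> 'a::real_normed_field) \<Rightarrow> 'a"
  assumes "poly_fun n d F" "F w \<noteq> 0" "finite T"
  shows "card {x \<in> {..<n} \<rightarrow>\<^sub>E T. F x = 0} * card T \<le> d * card T ^ n"
  using assms(1,2)
proof (induction n arbitrary: d F w)
  case 0
  then have "F x \<noteq> 0" for x using poly_fun_cong[of 0 d F x w] by simp
  then show ?case by simp
next
  case (Suc n)
  let ?E = "{..<n} \<rightarrow>\<^sub>E T"
  obtain G where G: "\<And>j. j \<le> d \<Longrightarrow> poly_fun n (d - j) (G j)"
    "\<And>u. F u = (\<Sum>j\<le>d. G j u * u n ^ j)"
    using poly_fun_split[OF Suc.prems(1)] by blast
  have "\<exists>j. j \<le> d \<and> (\<exists>v. G j v \<noteq> 0)"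
  proof (rule ccontr)
    assume "\<not> ?thesis"
    then have "F w = 0" unfolding G(2) by (intro sum.neutral) auto
    with Suc.prems(2) show False ..
  qed
  moreover define j where "j = (GREATEST j. j \<le> d \<and> (\<exists>v. G j v \<noteq> 0))"
  ultimately have j: "j \<le> d" "\<exists>v. G j v \<noteq> 0" and
    jmax: "\<And>i. i \<le> d \<Longrightarrow> \<exists>v. G i v \<noteq> 0 \<Longrightarrow> i \<le> j"
    using GreatestI_ex_nat[of "\<lambda>j. j \<le> d \<and> (\<exists>v. G j v \<noteq> 0)" d]
      Greatest_le_nat[of "\<lambda>j. j \<le> d \<and> (\<exists>v. G j v \<noteq> 0)" _ d] by auto
  have F: "F u = (\<Sum>i\<le>j. G i u * u n ^ i)" for u
    unfolding G(2)
  proof (intro sum.mono_neutral_right ballI)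
    fix i assume "i \<in> {..d} - {..j}"
    then have "G i u = 0" using jmax[of i] by auto
    then show "G i u * u n ^ i = 0" by simp
  qed (use j(1) in auto)
  define Z where "Z = {x \<in> ?E. G j x = 0}"
  define Y where "Y g = {y. (\<Sum>i\<le>j. G i g * y ^ i) = 0}" for g
  have finE: "finite ?E" using assms(3) by (simp add: finite_PiE)
  \<comment> \<open>Outside \<open>Z\<close> the coefficient of \<open>y ^ j\<close> is nonzero, so
    the root bound applies.\<close>
  have Y: "finite (Y g) \<and> card (Y g) \<le> j" if "g \<in> ?E - Z" for g
    unfolding Y_def using that by (intro polyfun_rootbound) (auto simp: Z_def)
  have "{x \<in> {..<Suc n} \<rightarrow>\<^sub>E T. F x = 0}
      \<subseteq> (\<lambda>(g, y). g(n := y)) ` (Z \<times> T \<union> (SIGMA g:?E - Z. Y g))"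
  proof
    fix x assume x: "x \<in> {x \<in> {..<Suc n} \<rightarrow>\<^sub>E T. F x = 0}"
    then obtain g y where gy: "g \<in> ?E" "y \<in> T" "x = g(n := y)"
      by (auto simp: lessThan_Suc PiE_insert_eq)
    have "G i x = G i g" if "i \<le> j" for i
      using that j(1) gy(3) by (intro poly_fun_cong[OF G(1)]) auto
    then have "(\<Sum>i\<le>j. G i g * y ^ i) = 0"
      using x unfolding F using gy(3) by simp
    then show "x \<in> (\<lambda>(g, y). g(n := y)) ` (Z \<times> T \<union> (SIGMA g:?E - Z. Y g))"
      using gy by (intro image_eqI[of _ _ "(g, y)"]) (auto simp: Y_def)
  qed
  moreover have fin: "finite (Z \<times> T \<union> (SIGMA g:?E - Z. Y g))"
    using Y finE assms(3) by (intro finite_UnI finite_cartesian_product finite_SigmaI) (auto simp: Z_def)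
  ultimately have "card {x \<in> {..<Suc n} \<rightarrow>\<^sub>E T. F x = 0} \<le> card (Z \<times> T \<union> (SIGMA g:?E - Z. Y g))"
    by (meson card_image_le card_mono finite_imageI order_trans)
  also have "\<dots> \<le> card (Z \<times> T) + card (SIGMA g:?E - Z. Y g)" by (rule card_Un_le)
  also have "\<dots> \<le> card Z * card T + card T ^ n * j"
  proof (rule add_mono)
    have "card (SIGMA g:?E - Z. Y g) = (\<Sum>g\<in>?E - Z. card (Y g))"
      using Y finE by (intro card_SigmaI) auto
    also have "\<dots> \<le> (\<Sum>g\<in>?E - Z. j)" using Y by (intro sum_mono) auto
    also have "\<dots> = card (?E - Z) * j" by simp
    also have "\<dots> \<le> card ?E * j" using finE by (intro mult_right_mono card_mono) auto
    finally show "card (SIGMA g:?E - Z. Y g) \<le> card T ^ n * j" by (simp add: card_funcsetE)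
  qed (simp add: card_cartesian_product)
  finally have "card {x \<in> {..<Suc n} \<rightarrow>\<^sub>E T. F x = 0} * card T
      \<le> (card Z * card T + card T ^ n * j) * card T"
    by (rule mult_right_mono) simp
  also have "\<dots> \<le> ((d - j) * card T ^ n + card T ^ n * j) * card T"
    using Suc.IH[OF G(1)[OF j(1)]] j(2) unfolding Z_def by (intro mult_right_mono add_mono) auto
  also have "\<dots> = d * card T ^ Suc n"
    using j(1) by (simp add: diff_mult_distrib algebra_simps)
  finally show ?case .
qed

section \<open>Zeros of exponential polynomials at rational points\<close>

lemma Rats_sum: "(\<And>i. i \<in> I \<Longrightarrow> f i \<in> \<rat>) \<Longrightarrow> sum f I \<in> \<rat>"
  by (induction I rule: infinite_finite_induct) auto

lemma Rats_prod: "(\<And>i. i \<in> I \<Longrightarrow> f i \<in> \<rat>) \<Longrightarrow> prod f I \<in> \<rat>"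
  by (induction I rule: infinite_finite_induct) auto

lemma peval_Rats:
  fixes u :: "nat \<Rightarrow> real"
  assumes "nvariate n f" "\<And>i. i < n \<Longrightarrow> u i \<in> \<rat>"
  shows "peval f u \<in> \<rat>"
  unfolding peval_def using assms
  by (intro Rats_sum Rats_mult Rats_of_int Rats_prod Rats_power) (auto simp: nvariate_def)

lemma exp_quotient_sum_zeros:
  fixes f g h :: "nat \<Rightarrow> (nat \<Rightarrow> real) \<Rightarrow> real"
  assumes poly: "\<And>i. i < k \<Longrightarrow> poly_fun n d (f i)" "\<And>i. i < k \<Longrightarrow> poly_fun n d (g i)"
      "\<And>i. i < k \<Longrightarrow> poly_fun n d (h i)"
    and T: "finite T"
    and rat: "\<And>i x. i < k \<Longrightarrow> x \<in> {..<n} \<rightarrow>\<^sub>E T \<Longrightarrow> f i x \<in> \<rat> \<and> g i x \<in> \<rat> \<and> h i x \<in> \<rat>"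
    and w: "\<And>i. i < k \<Longrightarrow> h i w \<noteq> 0" "(\<Sum>i<k. f i w * exp (g i w / h i w)) \<noteq> 0"
  shows "card {x \<in> {..<n} \<rightarrow>\<^sub>E T. (\<exists>i<k. h i x = 0) \<or> (\<Sum>i<k. f i x * exp (g i x / h i x)) = 0} * card T
    \<le> 4 * d * k\<^sup>2 * card T ^ n" (is "card ?B * _ \<le> _")
proof -
  let ?E = "{..<n} \<rightarrow>\<^sub>E T"
  define V where "V = {u. \<forall>i<k. h i u \<noteq> 0}"
  \<comment> \<open>Terms are grouped by their exponents as functions on \<open>V\<close>: exponents that agree there agree
    at every admissible point, and exponents that differ there are separated by the nonzero
    polynomial \<open>Q j\<close> below.\<close>
  define \<rho> where "\<rho> i = restrict (\<lambda>u. g i u / h i u) V" for i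
  define Z where "Z F = {x \<in> ?E. F x = 0}" for F :: "(nat \<Rightarrow> real) \<Rightarrow> real"
  have wV: "w \<in> V" using w(1) by (simp add: V_def)
  have "(\<Sum>i<k. f i w * exp (g i w / h i w))
      = (\<Sum>r\<in>\<rho> ` {..<k}. \<Sum>i\<in>{i \<in> {..<k}. \<rho> i = r}. f i w * exp (g i w / h i w))"
    by (rule sum.image_gen) simp
  \<comment> \<open>Some class has a nonzero partial sum at \<open>w\<close>; the common exponential
    factors out of it, which leaves \<open>F w\<close> nonzero.\<close>
  with w(2) have "\<exists>r\<in>\<rho> ` {..<k}. (\<Sum>i\<in>{i \<in> {..<k}. \<rho> i = r}. f i w * exp (g i w / h i w)) \<noteq> 0"
    by (metis (no_types, lifting) sum.neutral)
  then obtain i0 where i0: "i0 < k"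
    "(\<Sum>i\<in>{i \<in> {..<k}. \<rho> i = \<rho> i0}. f i w * exp (g i w / h i w)) \<noteq> 0"
    by auto
  define I where "I = {i \<in> {..<k}. \<rho> i = \<rho> i0}"
  define F where "F u = (\<Sum>i\<in>I. f i u)" for u
  define Q where "Q j u = g j u * h i0 u - g i0 u * h j u" for j u
  have \<rho>: "\<rho> i u = g i u / h i u" if "u \<in> V" for i u
    using that by (simp add: \<rho>_def)
  have "(\<Sum>i\<in>I. f i w * exp (g i w / h i w)) = (\<Sum>i\<in>I. f i w * exp (\<rho> i0 w))"
    by (intro sum.cong) (auto simp: I_def \<rho>[OF wV, symmetric])
  also have "\<dots> = F w * exp (\<rho> i0 w)" by (simp add: F_def sum_distrib_right)
  finally have Fw: "F w \<noteq> 0" using i0(2) unfolding I_def by auto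
  have polyF: "poly_fun n d F"
    unfolding F_def by (intro poly_fun_sum poly) (auto simp: I_def)
  have polyQ: "poly_fun n (d + d) (Q j)" if "j < k" for j
    unfolding Q_def using that i0(1) by (intro poly_fun_diff poly_fun_mult poly) auto
  have Q_nz: "\<exists>u. Q j u \<noteq> 0" if j: "j \<in> {..<k} - I" for j
  proof -
    have "\<rho> j \<noteq> \<rho> i0" using j by (auto simp: I_def)
    then obtain u where u: "u \<in> V" "g j u / h j u \<noteq> g i0 u / h i0 u"
      by (auto simp: \<rho>_def fun_eq_iff restrict_def split: if_splits)
    then have "Q j u \<noteq> 0" using j i0(1) by (auto simp: Q_def V_def frac_eq_eq)
    then show ?thesis by blast
  qed
  have finZ: "finite (Z G)" for G unfolding Z_def using T by (simp add: finite_PiE)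
  have "?B \<subseteq> ((\<Union>i<k. Z (h i)) \<union> Z F) \<union> (\<Union>j\<in>{..<k} - I. Z (Q j))"
  proof (rule subsetI, rule ccontr)
    fix x assume x: "x \<in> ?B" and "x \<notin> ((\<Union>i<k. Z (h i)) \<union> Z F) \<union> (\<Union>j\<in>{..<k} - I. Z (Q j))"
    then have xE: "x \<in> ?E" and xh: "\<And>i. i < k \<Longrightarrow> h i x \<noteq> 0" and xF: "F x \<noteq> 0"
      and xQ: "\<And>j. j \<in> {..<k} - I \<Longrightarrow> Q j x \<noteq> 0"
      by (auto simp: Z_def)
    then have xV: "x \<in> V" by (simp add: V_def)
    \<comment> \<open>Now terms are grouped by the numerical values of the exponents at
      \<open>x\<close>; such groups might merge several of the classes given by
      \<open>\<rho>\<close>.\<close>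
    define r where "r i = g i x / h i x" for i
    define c where "c q = (\<Sum>i\<in>{i \<in> {..<k}. r i = q}. f i x)" for q
    have "(\<Sum>q\<in>r ` {..<k}. c q * exp q) = (\<Sum>q\<in>r ` {..<k}. \<Sum>i\<in>{i \<in> {..<k}. r i = q}. f i x * exp (r i))"
      unfolding c_def sum_distrib_right by (intro sum.cong) auto
    also have "\<dots> = (\<Sum>i<k. f i x * exp (r i))"
      by (rule sum.image_gen[symmetric]) simp
    also have "\<dots> = 0" using x xh by (auto simp: r_def)
    finally have "c (r i0) = 0"
    proof (rule exp_Rats_linear_independent[rotated 3])
      show "r ` {..<k} \<subseteq> \<rat>" using rat xE by (auto simp: r_def)
      show "c q \<in> \<rat>" for q unfolding c_def using rat xE by (intro Rats_sum) auto
    qed (use i0(1) in auto)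
    \<comment> \<open>No merging happens for the class of \<open>i0\<close>: an index outside
      \<open>I\<close> with the same value would make its \<open>Q\<close> vanish at
      \<open>x\<close>.\<close>
    moreover have "{i \<in> {..<k}. r i = r i0} = I"
    proof (intro equalityI subsetI)
      fix i assume "i \<in> I"
      then show "i \<in> {i \<in> {..<k}. r i = r i0}"
        using \<rho>[OF xV] by (auto simp: I_def r_def) metis
    next
      fix i assume "i \<in> {i \<in> {..<k}. r i = r i0}"
      then have "i < k" "Q i x = 0" using xh i0(1) by (auto simp: r_def Q_def frac_eq_eq)
      then show "i \<in> I" using xQ[of i] by auto
    qed
    ultimately show False using xF by (simp add: c_def F_def)
  qed
  then have "card ?B \<le> card (((\<Union>i<k. Z (h i)) \<union> Z F) \<union> (\<Union>j\<in>{..<k} - I. Z (Q j)))"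
    using finZ by (intro card_mono) auto
  also have "\<dots> \<le> (\<Sum>i<k. card (Z (h i))) + card (Z F) + (\<Sum>j\<in>{..<k} - I. card (Z (Q j)))"
    by (intro order_trans[OF card_Un_le] add_mono card_UN_le) auto
  finally have "card ?B * card T \<le> \<dots> * card T" by (rule mult_right_mono) simp
  also have "\<dots> = (\<Sum>i<k. card (Z (h i)) * card T) + card (Z F) * card T
      + (\<Sum>j\<in>{..<k} - I. card (Z (Q j)) * card T)"
    by (simp add: distrib_right sum_distrib_right)
  also have "\<dots> \<le> (\<Sum>i<k. d * card T ^ n) + d * card T ^ n
      + (\<Sum>j\<in>{..<k} - I. (d + d) * card T ^ n)"
  proof (intro add_mono sum_mono)
    show "card (Z (h i)) * card T \<le> d * card T ^ n" if "i \<in> {..<k}" for i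
      unfolding Z_def using that by (intro Schwartz_Zippel[of _ _ _ w] poly w T) auto
    show "card (Z F) * card T \<le> d * card T ^ n"
      unfolding Z_def using Fw by (intro Schwartz_Zippel[of _ _ _ w] polyF T)
    show "card (Z (Q j)) * card T \<le> (d + d) * card T ^ n" if "j \<in> {..<k} - I" for j
      unfolding Z_def using Q_nz[OF that] that Schwartz_Zippel[OF polyQ _ T] by blast
  qed
  also have "\<dots> = (k + 1 + 2 * card ({..<k} - I)) * (d * card T ^ n)"
    by (simp add: algebra_simps)
  also have "\<dots> \<le> (4 * k\<^sup>2) * (d * card T ^ n)"
  proof (rule mult_right_mono)
    \<comment> \<open>\<open>i0 < k\<close> makes \<open>k\<close> positive, so 3 k + 1 is at most
      \<open>4 * k^2\<close>.\<close>
    have "card ({..<k} - I) \<le> k" using card_mono[of "{..<k}" "{..<k} - I"] by simp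
    moreover have "k * 1 \<le> k * k" using i0(1) by (intro mult_left_mono) auto
    ultimately show "k + 1 + 2 * card ({..<k} - I) \<le> 4 * k\<^sup>2"
      using i0(1) unfolding power2_eq_square by linarith
  qed simp
  finally show ?thesis by (simp add: mult_ac)
qed

text \<open>Unpacks the list into families indexed below \<open>k\<close>; integer coefficients make
  all values at rational points rational.\<close>

lemma expoly_real_zeros:
  assumes P: "expoly_of n k d P" and w: "expoly_real P w = Some y" "y \<noteq> 0"
    and T: "finite T" "T \<subseteq> \<rat>"
  shows "card {x \<in> {..<n} \<rightarrow>\<^sub>E T. expoly_real P x \<in> {Some 0, None}} * card T
    \<le> 4 * d * k\<^sup>2 * card T ^ n"
proof -
  define f g h :: "nat \<Rightarrow> (nat \<Rightarrow> real) \<Rightarrow> real" where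
    "f i = peval (fst (P ! i))" and "g i = peval (fst (snd (P ! i)))"
    and "h i = peval (snd (snd (P ! i)))" for i
  have len: "length P = k" using P by (simp add: expoly_of_def)
  have terms: "nvariate n r \<and> total_degree_le d r"
    if "i < k" "r \<in> {fst (P ! i), fst (snd (P ! i)), snd (snd (P ! i))}" for i r
    using P that nth_mem[of i P] unfolding expoly_of_def case_prod_unfold by auto
  have real: "expoly_real P u = (if \<forall>i<k. h i u \<noteq> 0
      then Some (\<Sum>i<k. f i u * exp (g i u / h i u)) else None)" for u :: "nat \<Rightarrow> real"
    unfolding expoly_real_def f_def g_def h_def sum_list_sum_nth
    by (auto simp: all_set_conv_all_nth len case_prod_unfold atLeast0LessThan intro!: sum.cong)
  have wh: "\<forall>i<k. h i w \<noteq> 0" "(\<Sum>i<k. f i w * exp (g i w / h i w)) \<noteq> 0"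
    using w unfolding real by (auto split: if_splits)
  have "card {x \<in> {..<n} \<rightarrow>\<^sub>E T. (\<exists>i<k. h i x = 0) \<or> (\<Sum>i<k. f i x * exp (g i x / h i x)) = 0} * card T
    \<le> 4 * d * k\<^sup>2 * card T ^ n"
  proof (rule exp_quotient_sum_zeros)
    fix i and x :: "nat \<Rightarrow> real" assume i: "i < k" and x: "x \<in> {..<n} \<rightarrow>\<^sub>E T"
    then have "x j \<in> \<rat>" if "j < n" for j using T(2) that by auto
    then show "f i x \<in> \<rat> \<and> g i x \<in> \<rat> \<and> h i x \<in> \<rat>"
      unfolding f_def g_def h_def using terms[OF i] by (auto intro!: peval_Rats)
  qed (use wh T(1) terms in \<open>auto simp: f_def g_def h_def intro!: poly_fun_peval\<close>)
  also have "{x \<in> {..<n} \<rightarrow>\<^sub>E T. (\<exists>i<k. h i x = 0) \<or> (\<Sum>i<k. f i x * exp (g i x / h i x)) = 0}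
      = {x \<in> {..<n} \<rightarrow>\<^sub>E T. expoly_real P x \<in> {Some 0, None}}"
    unfolding real by (intro Collect_cong conj_cong) auto
  finally show ?thesis .
qed

section \<open>From exponential polynomials to circuits\<close>

theorem theorem5p1:
  fixes n k d :: nat and C :: circuit and S :: "rat set"
  assumes "AExp1_circuit n C"
    and "has_width_degree n k d C"
    and "\<exists>u\<in>circuit_dom_real n C. circuit_real C u \<noteq> Some 0"
    and "finite S" and "S \<noteq> {}"
  shows "measure_pmf.prob (pmf_of_set ({..<n} \<rightarrow>\<^sub>E S))
           {x. circuit_real C (\<lambda>i\<in>{..<n}. of_rat (x i)) \<in> {Some 0, None}}
         \<le> 8 * real d * real k ^ 2 / real (card S)"
proof -
  obtain P P' where P: "expoly_of n k d P" "expoly_of n k d P'"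
    and dom: "circuit_dom_real n C = quotient_dom_real n P P'"
    and val: "\<And>u. u \<in> circuit_dom_real n C \<Longrightarrow>
      the (circuit_real C u) = the (expoly_real P u) / the (expoly_real P' u)"
    using assms(2) unfolding has_width_degree_def by blast
  obtain w where w: "w \<in> circuit_dom_real n C" "circuit_real C w \<noteq> Some 0" using assms(3) by blast
  then obtain y y' where y: "expoly_real P w = Some y" "expoly_real P' w = Some y'" "y' \<noteq> 0"
    unfolding dom by (auto simp: quotient_dom_real_def expoly_dom_real_def)
  obtain z where "circuit_real C w = Some z" "z \<noteq> 0"
    using w by (auto simp: circuit_dom_real_def)
  \<comment> \<open>So \<open>w\<close> is a point of nonvanishing for numerator and denominator
    alike.\<close>
  then have "y \<noteq> 0" using val[OF w(1)] y by auto
  define T :: "real set" where "T = of_rat ` S"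
  define \<phi> :: "(nat \<Rightarrow> rat) \<Rightarrow> nat \<Rightarrow> real" where "\<phi> x = (\<lambda>i\<in>{..<n}. of_rat (x i))" for x
  let ?E = "{..<n} \<rightarrow>\<^sub>E S" and ?E' = "{..<n} \<rightarrow>\<^sub>E T"
  let ?A = "{x. circuit_real C (\<phi> x) \<in> {Some 0, None}}"
  let ?B = "\<lambda>P. {x \<in> ?E'. expoly_real P x \<in> {Some 0, None}}"
  have T: "finite T" "T \<subseteq> \<rat>" "card T = card S"
    using assms(4) by (auto simp: T_def card_image inj_on_def)
  have finE: "finite ?E" "?E \<noteq> {}" "finite ?E'"
    using assms(4,5) T(1) by (auto simp: finite_PiE PiE_eq_empty_iff)
  have "inj_on \<phi> ?E"
  proof (rule inj_onI, rule PiE_ext)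
    fix x x' i assume eq: "\<phi> x = \<phi> x'" and i: "i \<in> {..<n}"
    have "\<phi> x i = \<phi> x' i" by (simp only: eq)
    then show "x i = x' i" using i by (simp add: \<phi>_def)
  qed
  \<comment> \<open>Where \<open>P\<close> and \<open>P'\<close> are both defined and nonzero, the
    circuit is defined and its value is a nonzero quotient.\<close>
  moreover have "\<phi> ` (?E \<inter> ?A) \<subseteq> ?B P \<union> ?B P'"
  proof (rule image_subsetI, rule ccontr)
    fix x assume x: "x \<in> ?E \<inter> ?A" and "\<phi> x \<notin> ?B P \<union> ?B P'"
    moreover have xE: "\<phi> x \<in> ?E'" using x by (auto simp: \<phi>_def T_def)
    ultimately obtain z z' where z: "expoly_real P (\<phi> x) = Some z" "z \<noteq> 0"
      "expoly_real P' (\<phi> x) = Some z'" "z' \<noteq> 0" by auto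
    then have d: "\<phi> x \<in> circuit_dom_real n C"
      unfolding dom using xE by (auto simp: quotient_dom_real_def expoly_dom_real_def PiE_def)
    then have "circuit_real C (\<phi> x) \<noteq> None" unfolding circuit_dom_real_def by blast
    with x have 0: "the (circuit_real C (\<phi> x)) = 0"
      by (elim IntE CollectE insertE) simp_all
    show False using val[OF d] z unfolding 0 by simp
  qed
  moreover have "finite (?B P \<union> ?B P')" using finE(3) by simp
  ultimately have "card (?E \<inter> ?A) \<le> card (?B P \<union> ?B P')"
    by (meson card_inj_on_le inf_le1 inj_on_subset)
  also have "\<dots> \<le> card (?B P) + card (?B P')" by (rule card_Un_le)
  finally have "card (?E \<inter> ?A) * card T \<le> (card (?B P) + card (?B P')) * card T"
    by (rule mult_right_mono) simp
  also have "\<dots> \<le> 4 * d * k\<^sup>2 * card T ^ n + 4 * d * k\<^sup>2 * card T ^ n"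
    unfolding distrib_right
    by (intro add_mono expoly_real_zeros[OF P(1) y(1) \<open>y \<noteq> 0\<close> T(1,2)]
        expoly_real_zeros[OF P(2) y(2,3) T(1,2)])
  finally have "card (?E \<inter> ?A) * card S \<le> 8 * d * k\<^sup>2 * card S ^ n"
    unfolding T(3) by (simp add: mult_ac)
  then have "real (card (?E \<inter> ?A)) * real (card S) \<le> 8 * real d * (real k)\<^sup>2 * real (card S) ^ n"
    by (simp only: of_nat_mult of_nat_power of_nat_numeral flip: of_nat_le_iff[where 'a = real])
  moreover have "card S > 0" using assms(4,5) by (simp add: card_gt_0_iff)
  ultimately have "real (card (?E \<inter> ?A)) / real (card S) ^ n \<le> 8 * real d * (real k)\<^sup>2 / real (card S)"
    by (simp add: field_simps)
  moreover have "measure_pmf.prob (pmf_of_set ?E) ?A = real (card (?E \<inter> ?A)) / real (card S) ^ n"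
    using finE by (simp add: measure_pmf_of_set card_funcsetE)
  ultimately show ?thesis unfolding \<phi>_def by simp
qed

end
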